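(* Let $E$ and $F$ be nonzero Banach lattices. Then the following assertions are equivalent: (1) Every order bounded operator $T : E \to F$ is order L-weakly compact. (2) The norm of $F$ is order continuous.
   Context: All Banach lattices are real; "operator" means bounded linear map. An operator between Banach lattices is order bounded if it maps order bounded sets to order bounded sets. A nonempty bounded subset $A$ of a Banach lattice $G$ is L-weakly compact if $\lim\|x_n\|=0$ for every disjoint sequence $(x_n)$ in the solid hull of $A$. An operator $T : E \to F$ between Banach lattices is order L-weakly compact if $T[0,x]$ is an L-weakly compact subset of $F$ for each $x\in E^+$. *)

theory Defs
  imports "HOL-Analysis.Analysis" "HOL-Library.Lattice_Algebras"
begin

class banach_lattice = banach + ordered_real_vector + lattice_ab_group_add_abs +
  assumes norm_mono_abs: "\<bar>x\<bar> \<le> \<bar>y\<bar> \<Longrightarrow> norm x \<le> norm y"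

instance real :: banach_lattice
  by standard simp

definition order_bounded_set :: "'a::banach_lattice set \<Rightarrow> bool" where
  "order_bounded_set A \<longleftrightarrow> (\<exists>a b. A \<subseteq> {a..b})"

definition order_bounded_map :: "('a::banach_lattice \<Rightarrow> 'b::banach_lattice) \<Rightarrow> bool" where
  "order_bounded_map T \<longleftrightarrow> (\<forall>A. order_bounded_set A \<longrightarrow> order_bounded_set (T ` A))"

definition solid_hull :: "'a::banach_lattice set \<Rightarrow> 'a set" where
  "solid_hull A = {x. \<exists>y\<in>A. \<bar>x\<bar> \<le> \<bar>y\<bar>}"

definition disjoint_seq :: "(nat \<Rightarrow> 'a::banach_lattice) \<Rightarrow> bool" where
  "disjoint_seq x \<longleftrightarrow> (\<forall>m n. m \<noteq> n \<longrightarrow> inf \<bar>x m\<bar> \<bar>x n\<bar> = 0)"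

definition L_weakly_compact :: "'a::banach_lattice set \<Rightarrow> bool" where
  "L_weakly_compact A \<longleftrightarrow> A \<noteq> {} \<and> bounded A \<and>
     (\<forall>x. disjoint_seq x \<and> range x \<subseteq> solid_hull A \<longrightarrow> (\<lambda>n. norm (x n)) \<longlonglongrightarrow> 0)"

definition order_L_weakly_compact :: "('a::banach_lattice \<Rightarrow> 'b::banach_lattice) \<Rightarrow> bool" where
  "order_L_weakly_compact T \<longleftrightarrow> (\<forall>x\<ge>0. L_weakly_compact (T ` {0..x}))"

definition directed_preorder :: "'i set \<Rightarrow> ('i \<Rightarrow> 'i \<Rightarrow> bool) \<Rightarrow> bool" where
  "directed_preorder I le \<longleftrightarrow> I \<noteq> {} \<and>
     (\<forall>i\<in>I. le i i) \<and>
     (\<forall>i\<in>I. \<forall>j\<in>I. \<forall>k\<in>I. le i j \<longrightarrow> le j k \<longrightarrow> le i k) \<and>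
     (\<forall>i\<in>I. \<forall>j\<in>I. \<exists>k\<in>I. le i k \<and> le j k)"

definition net_decreasing_to_0 ::
    "'i set \<Rightarrow> ('i \<Rightarrow> 'i \<Rightarrow> bool) \<Rightarrow> ('i \<Rightarrow> 'a::banach_lattice) \<Rightarrow> bool" where
  "net_decreasing_to_0 I le x \<longleftrightarrow>
     (\<forall>i\<in>I. \<forall>j\<in>I. le i j \<longrightarrow> x j \<le> x i) \<and>
     (\<forall>i\<in>I. 0 \<le> x i) \<and> (\<forall>z. (\<forall>i\<in>I. z \<le> x i) \<longrightarrow> z \<le> 0)"

definition net_norm_null ::
    "'i set \<Rightarrow> ('i \<Rightarrow> 'i \<Rightarrow> bool) \<Rightarrow> ('i \<Rightarrow> 'a::banach_lattice) \<Rightarrow> bool" where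
  "net_norm_null I le x \<longleftrightarrow> (\<forall>\<epsilon>>0. \<exists>i\<in>I. \<forall>j\<in>I. le i j \<longrightarrow> norm (x j) < \<epsilon>)"

text \<open>
  The norm is order continuous if every net decreasing to 0 converges to 0 in norm.  A definition
  cannot quantify over all index types, so the nets are indexed by directed preordered subsets of
  the space itself.  This loses no generality: by \<open>order_continuous_norm_net\<close> below, the property
  then holds for nets over index sets of an arbitrary type.
\<close>

definition order_continuous_norm :: "'a::banach_lattice itself \<Rightarrow> bool" where
  "order_continuous_norm _ \<longleftrightarrow>
     (\<forall>(I :: 'a set) le (x :: 'a \<Rightarrow> 'a).
        directed_preorder I le \<and> net_decreasing_to_0 I le x \<longrightarrow> net_norm_null I le x)"

lemma order_continuous_norm_net:
  fixes x :: "'i \<Rightarrow> 'a::banach_lattice"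
  assumes oc: "order_continuous_norm TYPE('a)"
    and dir: "directed_preorder I le" and dec: "net_decreasing_to_0 I le x"
  shows "net_norm_null I le x"
proof -
  have mono: "x j \<le> x i" if "i \<in> I" "j \<in> I" "le i j" for i j
    using dec that unfolding net_decreasing_to_0_def by blast
  have ub: "\<exists>k\<in>I. x k \<le> x i \<and> x k \<le> x j" if "i \<in> I" "j \<in> I" for i j
  proof -
    have "\<forall>i\<in>I. \<forall>j\<in>I. \<exists>k\<in>I. le i k \<and> le j k"
      using dir unfolding directed_preorder_def by (elim conjE)
    with that obtain k where "k \<in> I" "le i k" "le j k"
      by blast
    then show ?thesis
      using mono that by blast
  qed
  have "I \<noteq> {}"
    using dir unfolding directed_preorder_def by (rule conjunct1)
  have dir': "directed_preorder (x ` I) (\<lambda>a b. b \<le> a)"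
    unfolding directed_preorder_def
  proof (intro conjI ballI impI)
    show "x ` I \<noteq> {}"
      using \<open>I \<noteq> {}\<close> by simp
    fix a b assume "a \<in> x ` I" "b \<in> x ` I"
    then obtain i j where "i \<in> I" "j \<in> I" "a = x i" "b = x j"
      by (elim imageE)
    with ub[of i j] show "\<exists>c\<in>x ` I. c \<le> a \<and> c \<le> b"
      by simp
  next
    fix a b c :: 'a assume "b \<le> a" "c \<le> b"
    then show "c \<le> a"
      by (rule order_trans[rotated])
  qed simp
  have dec': "net_decreasing_to_0 (x ` I) (\<lambda>a b. b \<le> a) (\<lambda>a. a)"
    using dec unfolding net_decreasing_to_0_def by simp
  have null: "net_norm_null (x ` I) (\<lambda>a b. b \<le> a) (\<lambda>a. a)"
    by (intro oc[unfolded order_continuous_norm_def, rule_format] conjI dir' dec')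
  show ?thesis
    unfolding net_norm_null_def
  proof (intro allI impI)
    fix \<epsilon> :: real assume "\<epsilon> > 0"
    with null have "\<exists>i\<in>I. \<forall>j\<in>I. x j \<le> x i \<longrightarrow> norm (x j) < \<epsilon>"
      unfolding net_norm_null_def by simp
    then obtain i where "i \<in> I" and i: "\<And>j. j \<in> I \<Longrightarrow> x j \<le> x i \<Longrightarrow> norm (x j) < \<epsilon>"
      by blast
    have "norm (x j) < \<epsilon>" if "j \<in> I" "le i j" for j
      using that \<open>i \<in> I\<close> by (intro i mono)
    with \<open>i \<in> I\<close> show "\<exists>i\<in>I. \<forall>j\<in>I. le i j \<longrightarrow> norm (x j) < \<epsilon>"
      by (intro bexI[of _ i] ballI impI)
  qed
qed

end

theory Submission
  imports Defs
begin

text \<open>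
  Both conditions are equivalent to the statement that every disjoint sequence in an order interval
  of \<open>F\<close> is norm null.  If the norm is order continuous, the partial sums \<open>s n\<close> of such a sequence
  are bounded above, and the differences \<open>u - s n\<close>, where \<open>u\<close> runs over their upper bounds, decrease
  to \<open>0\<close> because \<open>F\<close> is Archimedean.  If every operator is order L-weakly compact, apply this to the
  rank one operators \<open>f \<otimes> c\<close> with \<open>f\<close> a bounded functional on \<open>E\<close>.  Conversely, let
  disjoint order bounded sequences be null.  Then so are order bounded sequences in which any \<open>k\<close>
  terms have infimum \<open>0\<close> (induction on \<open>k\<close>).  If \<open>u n \<ge> 0\<close> has partial sums below \<open>c\<close>, this applies to
  \<open>(u n - c / k)\<^sup>+\<close>, so \<open>u n\<close> is null.  Hence decreasing nets are Cauchy, and the limit of such a net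
  is its infimum.
\<close>

section \<open>Linear functionals below a sublinear one\<close>

text \<open>Scaling is only demanded as an inequality for positive scalars, the form that infima
  inherit directly; using it for \<open>inverse t\<close> too turns it into an equality.\<close>

definition sublinear :: "('a::real_vector \<Rightarrow> real) \<Rightarrow> bool" where
  "sublinear p \<longleftrightarrow> (\<forall>x y. p (x + y) \<le> p x + p y) \<and> (\<forall>t x. 0 < t \<longrightarrow> p (t *\<^sub>R x) \<le> t * p x)"

lemma sublinear_add: "sublinear p \<Longrightarrow> p (x + y) \<le> p x + p y"
  by (simp add: sublinear_def)

lemma sublinear_zero:
  assumes "sublinear p"
  shows "p 0 = 0"
proof -
  have "p ((1/2) *\<^sub>R 0) \<le> (1/2) * p 0"
    using assms unfolding sublinear_def by (metis half_gt_zero_iff zero_less_one)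
  then show ?thesis
    using sublinear_add[OF assms, of 0 0] by simp
qed

lemma sublinear_scaleR:
  assumes "sublinear p" "0 \<le> t"
  shows "p (t *\<^sub>R x) = t * p x"
proof (cases "t = 0")
  case False
  then have "0 < t"
    using assms by simp
  then have 1: "p (t *\<^sub>R x) \<le> t * p x"
    using assms unfolding sublinear_def by blast
  have "p (inverse t *\<^sub>R t *\<^sub>R x) \<le> inverse t * p (t *\<^sub>R x)"
    using assms \<open>0 < t\<close> unfolding sublinear_def by (meson positive_imp_inverse_positive)
  then have "t * p x \<le> p (t *\<^sub>R x)"
    using \<open>0 < t\<close> by (simp add: field_simps)
  with 1 show ?thesis
    by simp
qed (simp add: sublinear_zero[OF assms(1)])

lemma sublinear_lower: "sublinear p \<Longrightarrow> - p (- x) \<le> p x"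
  using sublinear_add[of p x "- x"] sublinear_zero[of p] by simp

text \<open>The infimum of \<open>p (x + t *\<^sub>R y) - t * p y\<close> over
  \<open>t \<ge> 0\<close> is the largest sublinear functional with these bounds. It is finite
  because \<open>- p (- x)\<close> bounds the family below; \<open>t = 0\<close> gives
  \<open>q \<le> p\<close>, and \<open>t = 1\<close> at \<open>- y\<close> gives the last
  bound.\<close>

lemma sublinear_decrease:
  assumes p: "sublinear p"
  shows "\<exists>q. sublinear q \<and> q \<le> p \<and> q (- y) \<le> - p y"
proof -
  define h where "h x t = p (x + t *\<^sub>R y) - t * p y" for x t
  define q where "q x = (INF t\<in>{0..}. h x t)" for x
  have "- p (- x) \<le> h x t" if "0 \<le> t" for x t
    using sublinear_add[OF p, of "x + t *\<^sub>R y" "- x"] sublinear_scaleR[OF p that, of y]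
    by (simp add: h_def)
  then have bdd: "bdd_below (h x ` {0..})" for x
    by (intro bdd_belowI2[where m = "- p (- x)"]) simp
  have lower: "q x \<le> h x t" if "0 \<le> t" for x t
    unfolding q_def using that by (intro cINF_lower bdd) simp
  have greatest: "c \<le> q x" if "\<And>t. 0 \<le> t \<Longrightarrow> c \<le> h x t" for c x
    unfolding q_def using that by (intro cINF_greatest) auto
  have add: "q (x + x') \<le> q x + q x'" for x x'
  proof -
    have "q (x + x') - h x t \<le> h x' t'" if "0 \<le> t" "0 \<le> t'" for t t'
      using lower[of "t + t'" "x + x'"] that
        sublinear_add[OF p, of "x + t *\<^sub>R y" "x' + t' *\<^sub>R y"]
      by (simp add: h_def algebra_simps)
    then have "q (x + x') - h x t \<le> q x'" if "0 \<le> t" for t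
      using that by (intro greatest)
    then have "q (x + x') - q x' \<le> q x"
      by (intro greatest) (simp add: algebra_simps)
    then show ?thesis
      by simp
  qed
  have scale: "q (s *\<^sub>R x) \<le> s * q x" if "0 < s" for s x
  proof -
    have "q (s *\<^sub>R x) / s \<le> h x t" if "0 \<le> t" for t
      using lower[of "s * t" "s *\<^sub>R x"] \<open>0 < s\<close> that
        sublinear_scaleR[OF p, of s "x + t *\<^sub>R y"]
      by (simp add: h_def field_simps scaleR_add_right)
    then have "q (s *\<^sub>R x) / s \<le> q x"
      by (rule greatest)
    then show ?thesis
      using that by (simp add: field_simps)
  qed
  have "q x \<le> p x" for x
    using lower[of 0 x] by (simp add: h_def)
  moreover have "q (- y) \<le> - p y"
    using lower[of 1 "- y"] sublinear_zero[OF p] by (simp add: h_def)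
  ultimately show ?thesis
    using add scale unfolding sublinear_def le_fun_def by blast
qed

text \<open>The pointwise infimum is finite since \<open>p \<le> q\<close> forces
  \<open>- q (- x) \<le> p x\<close>. It is subadditive because of two members of a chain the
  smaller one can serve for both summands.\<close>

lemma sublinear_chain_INF:
  fixes C :: "('a::real_vector \<Rightarrow> real) set"
  assumes "C \<noteq> {}" and sub: "\<And>p. p \<in> C \<Longrightarrow> sublinear p \<and> p \<le> q"
    and chain: "\<And>p p'. p \<in> C \<Longrightarrow> p' \<in> C \<Longrightarrow> p \<le> p' \<or> p' \<le> p"
  shows "\<exists>r. sublinear r \<and> (\<forall>p\<in>C. r \<le> p)"
proof -
  define r where "r x = (INF p\<in>C. p x)" for x
  have "- q (- x) \<le> p x" if "p \<in> C" for p x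
    using sub[OF that] sublinear_lower[of p x] le_funD[of p q "- x"] by simp
  then have bdd: "bdd_below ((\<lambda>p. p x) ` C)" for x
    by (intro bdd_belowI2)
  have lower: "r x \<le> p x" if "p \<in> C" for x p
    unfolding r_def using that by (intro cINF_lower bdd)
  have greatest: "c \<le> r x" if "\<And>p. p \<in> C \<Longrightarrow> c \<le> p x" for c x
    unfolding r_def using that \<open>C \<noteq> {}\<close> by (intro cINF_greatest)
  have add: "r (x + y) \<le> r x + r y" for x y
  proof -
    have "r (x + y) - p x \<le> p' y" if "p \<in> C" "p' \<in> C" for p p'
      using chain[OF that] lower[OF that(1), of "x + y"] lower[OF that(2), of "x + y"]
        sublinear_add[of p x y] sublinear_add[of p' x y] sub[OF that(1)] sub[OF that(2)]
      by (smt (verit) le_funD)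
    then have "r (x + y) - p x \<le> r y" if "p \<in> C" for p
      using that by (intro greatest)
    then have "r (x + y) - r y \<le> r x"
      by (intro greatest) (simp add: algebra_simps)
    then show ?thesis
      by simp
  qed
  have scale: "r (s *\<^sub>R x) \<le> s * r x" if "0 < s" for s x
  proof -
    have "r (s *\<^sub>R x) / s \<le> p x" if "p \<in> C" for p
      using lower[OF that, of "s *\<^sub>R x"] \<open>0 < s\<close> sub[OF that] sublinear_scaleR[of p s x]
      by (simp add: field_simps)
    then have "r (s *\<^sub>R x) / s \<le> r x"
      by (rule greatest)
    then show ?thesis
      using that by (simp add: field_simps)
  qed
  show ?thesis
    using add scale lower unfolding sublinear_def le_fun_def by blast
qed

text \<open>A minimal sublinear functional is linear: otherwise \<open>sublinear_decrease\<close> would lower it.\<close>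

lemma linear_below_sublinear:
  fixes q :: "'a::real_vector \<Rightarrow> real"
  assumes q: "sublinear q"
  shows "\<exists>f. linear f \<and> f \<le> q"
proof -
  define S where "S = {p. sublinear p \<and> p \<le> q}"
  have "\<exists>m\<in>S. \<forall>p\<in>S. p \<le> m \<longrightarrow> p = m"
  \<comment> \<open>The order is reversed, so that a maximal element is a minimal functional. The
    empty chain is bounded by \<open>q\<close> itself.\<close>
  proof (rule predicate_Zorn)
    show "partial_order_on S (relation_of (\<lambda>p p'. p' \<le> p) S)"
      by (rule partial_order_on_relation_ofI) auto
    show "\<exists>u\<in>S. \<forall>p\<in>C. u \<le> p" if "C \<in> Chains (relation_of (\<lambda>p p'. p' \<le> p) S)" for C
    proof (cases "C = {}")
      case True
      then show ?thesis
        using q by (auto simp: S_def)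
    next
      case False
      have sub: "p \<in> S" if "p \<in> C" for p
        using \<open>C \<in> _\<close> that unfolding Chains_def relation_of_def by blast
      have chain: "p \<le> p' \<or> p' \<le> p" if "p \<in> C" "p' \<in> C" for p p'
        using \<open>C \<in> _\<close> that unfolding Chains_def relation_of_def by blast
      obtain r where r: "sublinear r" "\<forall>p\<in>C. r \<le> p"
        using sublinear_chain_INF[OF False, of q] sub chain unfolding S_def by blast
      moreover have "r \<le> q"
        using False r(2) sub unfolding S_def by (blast intro: order_trans)
      ultimately show ?thesis
        unfolding S_def by blast
    qed
  qed
  then obtain f where f: "f \<in> S" and min: "\<And>p. p \<in> S \<Longrightarrow> p \<le> f \<Longrightarrow> p = f"
    by blast
  then have sub: "sublinear f" and "f \<le> q"
    by (auto simp: S_def)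
  have minus: "f (- y) = - f y" for y
  proof -
    obtain p where "sublinear p" "p \<le> f" "p (- y) \<le> - f y"
      using sublinear_decrease[OF sub] by blast
    then have "f (- y) \<le> - f y"
      using min[of p] \<open>f \<le> q\<close> unfolding S_def by (auto dest: order_trans)
    then show ?thesis
      using sublinear_lower[OF sub, of y] by simp
  qed
  have "linear f"
  proof (rule linearI)
    show "f (x + y) = f x + f y" for x y
      using sublinear_add[OF sub, of x y] sublinear_add[OF sub, of "x + y" "- y"] minus[of y]
      by simp
    show "f (t *\<^sub>R x) = t *\<^sub>R f x" for t x
      using sublinear_scaleR[OF sub, of t x] sublinear_scaleR[OF sub, of "- t" x]
        minus[of "t *\<^sub>R x"]
      by (cases "0 \<le> t") auto
  qed
  with \<open>f \<le> q\<close> show ?thesis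
    by blast
qed

text \<open>Hahn-Banach: lower the norm to \<open>q\<close> with
  \<open>q (- a) \<le> - norm a\<close>. A linear \<open>g \<le> q\<close> is dominated by the norm
  and has \<open>g a \<ge> norm a > 0\<close>; normalize it at \<open>a\<close>.\<close>

lemma bounded_functional_nonzero:
  fixes a :: "'a::real_normed_vector"
  assumes "a \<noteq> 0"
  shows "\<exists>f :: 'a \<Rightarrow> real. bounded_linear f \<and> f a = 1"
proof -
  have "sublinear (norm :: 'a \<Rightarrow> real)"
    by (simp add: sublinear_def norm_triangle_ineq)
  then obtain q :: "'a \<Rightarrow> real" where q: "sublinear q" "q \<le> norm" "q (- a) \<le> - norm a"
    using sublinear_decrease by blast
  obtain g where g: "linear g" "g \<le> q"
    using linear_below_sublinear[OF q(1)] by blast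
  have le: "g x \<le> norm x" for x
    using g(2) q(2) by (meson le_funD order_trans)
  have "g (- a) \<le> - norm a"
    using le_funD[OF g(2), of "- a"] q(3) by simp
  then have pos: "g a > 0"
    using assms linear_neg[OF g(1)] by (smt (verit) zero_less_norm_iff)
  have "\<bar>g x\<bar> \<le> norm x" for x
    using le[of x] le[of "- x"] linear_neg[OF g(1), of x] by (simp add: abs_le_iff)
  then have "bounded_linear g"
    by (intro bounded_linear_intro[where K = 1]) (simp_all add: linear_add[OF g(1)] linear_cmul[OF g(1)])
  from bounded_linear_compose[OF bounded_linear_divide[of "g a"] this]
  have "bounded_linear (\<lambda>x. g x / g a)"
    by (simp add: comp_def)
  with pos show ?thesis
    by (intro exI[of _ "\<lambda>x. g x / g a"]) auto
qed

section \<open>Norm and order in Banach lattices\<close>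

\<comment> \<open>Translations preserve infima: \<open>sup x y\<close> and \<open>sup x z\<close>
  lie below \<open>t + (y - v)\<close> and \<open>t + (z - v)\<close>, whose infimum is
  \<open>t + (v - v) = t\<close>.\<close>
subclass (in lattice_ab_group_add) distrib_lattice
proof
  fix x y z :: 'a
  define t v where "t = sup x (inf y z)" and "v = inf y z"
  have *: "sup x y' \<le> t + (y' - v)" if "y' = y \<or> y' = z" for y'
  proof (rule sup_least)
    have "v \<le> y'"
      using that by (auto simp: v_def)
    then have "0 \<le> y' - v"
      by simp
    then have "t \<le> t + (y' - v)"
      by simp
    then show "x \<le> t + (y' - v)"
      by (rule order.trans[rotated]) (simp add: t_def)
    have "v + (y' - v) \<le> t + (y' - v)"
      by (rule add_right_mono) (simp add: t_def v_def)
    then show "y' \<le> t + (y' - v)"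
      by (simp add: algebra_simps)
  qed
  have "inf (sup x y) (sup x z) \<le> inf (t + (y - v)) (t + (z - v))"
    by (intro inf_mono *) simp_all
  also have "\<dots> = t + (v - v)"
    unfolding v_def diff_conv_add_uminus by (simp only: add_inf_distrib_left add_inf_distrib_right)
  finally have "inf (sup x y) (sup x z) \<le> t"
    by simp
  then show "sup x (inf y z) = inf (sup x y) (sup x z)"
    unfolding t_def by (intro order.antisym distrib_sup_le)
qed

lemma norm_abs_lattice [simp]: "norm \<bar>x\<bar> = norm (x::'a::banach_lattice)"
  by (intro antisym norm_mono_abs) auto

lemma norm_mono_nonneg: "0 \<le> x \<Longrightarrow> x \<le> y \<Longrightarrow> norm x \<le> norm (y::'a::banach_lattice)"
  by (intro norm_mono_abs) (auto simp: order_trans)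

text \<open>The positive cone is closed: \<open>x n \<ge> 0\<close> gives
  \<open>- y \<le> x n - y\<close>, so the negative part of \<open>y\<close> is dominated by
  \<bar>\<open>x n - y\<close>\<bar>, which tends to 0 in norm.\<close>

lemma tendsto_nonneg_lattice:
  fixes y :: "'a::banach_lattice"
  assumes "x \<longlonglongrightarrow> y" "\<And>n. 0 \<le> x n"
  shows "0 \<le> y"
proof -
  have "norm (sup (- y) 0) \<le> norm (x n - y)" for n
  proof -
    have "- y \<le> \<bar>x n - y\<bar>"
      using assms(2)[of n] abs_ge_self[of "x n - y"]
      by (smt (verit) add.commute add_increasing diff_conv_add_uminus order_trans order_refl)
    then show ?thesis
      using norm_mono_nonneg[of "sup (- y) 0" "\<bar>x n - y\<bar>"] by simp
  qed
  moreover have "(\<lambda>n. norm (x n - y)) \<longlonglongrightarrow> 0"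
    using assms(1) by (simp add: LIM_zero tendsto_norm_zero)
  ultimately have "norm (sup (- y) 0) \<le> 0"
    by (intro LIMSEQ_le_const) auto
  then show ?thesis
    by (metis neg_le_0_iff_le norm_le_zero_iff sup.cobounded1)
qed

lemma tendsto_le_lattice:
  fixes x y :: "nat \<Rightarrow> 'a::banach_lattice"
  assumes "x \<longlonglongrightarrow> a" "y \<longlonglongrightarrow> b" "\<And>n. x n \<le> y n"
  shows "a \<le> b"
  using tendsto_nonneg_lattice[OF tendsto_diff[OF assms(2,1)]] assms(3) by simp

lemma le_suminf_lattice:
  fixes f :: "nat \<Rightarrow> 'a::banach_lattice"
  assumes "summable f" "\<And>n. 0 \<le> f n"
  shows "f k \<le> suminf f"
proof (rule tendsto_le_lattice)
  \<comment> \<open>The shift makes every partial sum contain the term \<open>f k\<close>.\<close>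
  show "(\<lambda>n. \<Sum>i<n + Suc k. f i) \<longlonglongrightarrow> suminf f"
    using summable_LIMSEQ[OF assms(1)] by (rule LIMSEQ_ignore_initial_segment)
  show "f k \<le> (\<Sum>i<n + Suc k. f i)" for n
    using sum_mono2[of "{..<n + Suc k}" "{k}" f] assms(2) by simp
qed auto

text \<open>Divide by \<open>Suc n\<close> and let \<open>n\<close> grow; the positive cone is
  closed.\<close>

lemma archimedean_lattice:
  fixes z :: "'a::banach_lattice"
  assumes "\<And>k::nat. of_nat k *\<^sub>R z \<le> w"
  shows "z \<le> 0"
proof -
  have "- z \<ge> 0"
  proof (rule tendsto_nonneg_lattice)
    have "(\<lambda>n. inverse (real (Suc n)) *\<^sub>R w - z) \<longlonglongrightarrow> 0 *\<^sub>R w - z"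
      by (intro tendsto_intros LIMSEQ_inverse_real_of_nat)
    then show "(\<lambda>n. inverse (real (Suc n)) *\<^sub>R w - z) \<longlonglongrightarrow> - z"
      by simp
    show "0 \<le> inverse (real (Suc n)) *\<^sub>R w - z" for n
      using scaleR_left_mono[OF assms[of "Suc n"], of "inverse (real (Suc n))"]
      by (simp del: of_nat_Suc)
  qed
  then show ?thesis
    by simp
qed

text \<open>A sum of two disjoint positive elements is their supremum. The second conjunct keeps the
  partial sum disjoint from the later terms, which the induction needs.\<close>

lemma sum_disjoint_le:
  fixes x :: "nat \<Rightarrow> 'a::banach_lattice"
  assumes nonneg: "\<And>n. 0 \<le> x n" and le: "\<And>n. x n \<le> c"
    and disj: "\<And>m n. m \<noteq> n \<Longrightarrow> inf (x m) (x n) = 0"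
  shows "(\<Sum>i<n. x i) \<le> c \<and> (\<forall>m\<ge>n. inf (\<Sum>i<n. x i) (x m) = 0)"
proof (induction n)
  case 0
  then show ?case
    using nonneg[of 0] le[of 0] nonneg by (auto intro: order_trans simp: inf_absorb1)
next
  case (Suc n)
  have sup: "(\<Sum>i<Suc n. x i) = sup (\<Sum>i<n. x i) (x n)"
    using Suc add_eq_inf_sup[of "\<Sum>i<n. x i" "x n"] by simp
  have "inf (\<Sum>i<Suc n. x i) (x m) = 0" if "Suc n \<le> m" for m
    using Suc that disj[of n m] unfolding sup inf_sup_distrib2 by simp
  moreover have "(\<Sum>i<Suc n. x i) \<le> c"
    unfolding sup using Suc le by simp
  ultimately show ?case
    by blast
qed

section \<open>Disjoint sequences under an order continuous norm\<close>

lemma order_continuous_disjoint_null: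
  fixes x :: "nat \<Rightarrow> 'a::banach_lattice"
  assumes oc: "order_continuous_norm TYPE('a)"
    and nonneg: "\<And>n. 0 \<le> x n" and le: "\<And>n. x n \<le> c"
    and disj: "\<And>m n. m \<noteq> n \<Longrightarrow> inf (x m) (x n) = 0"
  shows "(\<lambda>n. norm (x n)) \<longlonglongrightarrow> 0"
proof -
  define s where "s n = (\<Sum>i<n. x i)" for n
  define U where "U = {u. \<forall>n. s n \<le> u}"
  \<comment> \<open>Going up in \<open>R\<close> lowers the upper bound and lengthens the partial
    sum. The index set consists of pairs, so \<open>order_continuous_norm_net\<close> is
    required.\<close>
  define R :: "'a \<times> nat \<Rightarrow> 'a \<times> nat \<Rightarrow> bool" where
    "R = (\<lambda>(u, n) (v, m). v \<le> u \<and> n \<le> m)"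
  have "c \<in> U"
    using sum_disjoint_le[of x c, OF nonneg le disj] by (simp add: U_def s_def)
  have mono: "s n \<le> s m" if "n \<le> m" for n m
    unfolding s_def using that nonneg by (intro sum_mono2) auto
  have dir: "directed_preorder (U \<times> UNIV) R"
    unfolding directed_preorder_def
  proof (intro conjI ballI impI)
    show "U \<times> UNIV \<noteq> {}"
      using \<open>c \<in> U\<close> by auto
    fix i j assume "i \<in> U \<times> (UNIV :: nat set)" "j \<in> U \<times> (UNIV :: nat set)"
    then have "(inf (fst i) (fst j), max (snd i) (snd j)) \<in> U \<times> UNIV"
      by (auto simp: U_def)
    then show "\<exists>k\<in>U \<times> UNIV. R i k \<and> R j k"
      by (rule bexI[rotated]) (auto simp: R_def split: prod.splits)
  qed (auto simp: R_def)
  have "z \<le> 0" if z: "\<forall>i\<in>U \<times> UNIV. z \<le> fst i - s (snd i)" for z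
  proof (rule archimedean_lattice)
    \<comment> \<open>Subtracting \<open>z\<close> maps the set of upper bounds into itself.\<close>
    have "c - of_nat k *\<^sub>R z \<in> U" for k :: nat
    proof (induction k)
      case (Suc k)
      have "s n \<le> c - of_nat (Suc k) *\<^sub>R z" for n
        using bspec[OF z, of "(c - of_nat k *\<^sub>R z, n)"] Suc
        by (simp add: algebra_simps)
      then show ?case
        by (simp add: U_def)
    qed (simp add: \<open>c \<in> U\<close>)
    then have "s 0 \<le> c - of_nat k *\<^sub>R z" for k :: nat
      unfolding U_def by blast
    then show "of_nat k *\<^sub>R z \<le> c" for k :: nat
      by (simp add: s_def)
  qed
  then have dec: "net_decreasing_to_0 (U \<times> UNIV) R (\<lambda>i. fst i - s (snd i))"
    unfolding net_decreasing_to_0_def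
    by (auto simp: R_def U_def intro!: diff_mono mono)
  have null: "net_norm_null (U \<times> UNIV) R (\<lambda>i. fst i - s (snd i))"
    by (rule order_continuous_norm_net[OF oc dir dec])
  show ?thesis
  proof (rule LIMSEQ_I)
    fix e :: real assume "0 < e"
    then obtain u n where u: "u \<in> U"
      and small: "\<And>j. j \<in> U \<times> UNIV \<Longrightarrow> R (u, n) j \<Longrightarrow> norm (fst j - s (snd j)) < e"
      using null unfolding net_norm_null_def by (metis (no_types, lifting) SigmaE)
    have "norm (x m) < e" if "n \<le> m" for m
    proof -
      \<comment> \<open>The sum up to and including \<open>x m\<close> is still below
        \<open>u\<close>, so the net dominates \<open>x m\<close>.\<close>
      have "s (Suc m) \<le> u"
        using u unfolding U_def by blast
      then have "x m \<le> u - s m"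
        by (simp add: s_def algebra_simps)
      then have "norm (x m) \<le> norm (u - s m)"
        by (intro norm_mono_nonneg nonneg)
      also have "\<dots> < e"
        using small[of "(u, m)"] u that by (simp add: R_def)
      finally show ?thesis .
    qed
    then show "\<exists>n. \<forall>m\<ge>n. norm (norm (x m) - 0) < e"
      by auto
  qed
qed

text \<open>One element \<open>c\<close> dominates the moduli of the image of the interval, hence
  those of its solid hull, so the previous lemma applies to the moduli of a disjoint sequence
  there.\<close>

lemma order_bounded_imp_order_L_weakly_compact:
  fixes T :: "'a::banach_lattice \<Rightarrow> 'b::banach_lattice"
  assumes oc: "order_continuous_norm TYPE('b)" and T: "order_bounded_map T"
  shows "order_L_weakly_compact T"
  unfolding order_L_weakly_compact_def
proof (intro allI impI)
  fix a :: 'a assume "0 \<le> a"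
  have "order_bounded_set {0..a}"
    unfolding order_bounded_set_def by blast
  with T have "order_bounded_set (T ` {0..a})"
    unfolding order_bounded_map_def by blast
  then obtain l u where lu: "T ` {0..a} \<subseteq> {l..u}"
    unfolding order_bounded_set_def by blast
  define c where "c = sup \<bar>l\<bar> \<bar>u\<bar>"
  have c: "\<bar>y\<bar> \<le> c" if "y \<in> T ` {0..a}" for y
  proof (rule abs_leI)
    have "l \<le> y" "y \<le> u"
      using that lu by auto
    then show "y \<le> c"
      using abs_ge_self[of u] by (auto simp: c_def intro: le_supI2 order_trans)
    have "- y \<le> - l"
      using \<open>l \<le> y\<close> by simp
    then show "- y \<le> c"
      using abs_ge_minus_self[of l] unfolding c_def by (blast intro: le_supI1 order_trans)
  qed
  show "L_weakly_compact (T ` {0..a})"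
    unfolding L_weakly_compact_def
  proof (intro conjI allI impI)
    show "T ` {0..a} \<noteq> {}"
      using \<open>0 \<le> a\<close> by auto
    show "bounded (T ` {0..a})"
      using c unfolding bounded_iff by (metis abs_ge_zero norm_abs_lattice norm_mono_nonneg)
    fix x assume x: "disjoint_seq x \<and> range x \<subseteq> solid_hull (T ` {0..a})"
    then have "\<bar>x n\<bar> \<le> c" for n
      using c unfolding solid_hull_def by (blast intro: order_trans)
    then have "(\<lambda>n. norm \<bar>x n\<bar>) \<longlonglongrightarrow> 0"
      using x by (intro order_continuous_disjoint_null[OF oc]) (auto simp: disjoint_seq_def)
    then show "(\<lambda>n. norm (x n)) \<longlonglongrightarrow> 0"
      by simp
  qed
qed

section \<open>Order continuity from disjoint sequences\<close>

definition disjoint_null :: "'a::banach_lattice itself \<Rightarrow> bool" where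
  "disjoint_null _ \<longleftrightarrow> (\<forall>(x :: nat \<Rightarrow> 'a) c. disjoint_seq x \<and> (\<forall>n. 0 \<le> x n \<and> x n \<le> c) \<longrightarrow>
     (\<lambda>n. norm (x n)) \<longlonglongrightarrow> 0)"

text \<open>Since \<open>f\<close> is 1 at the modulus of \<open>e\<close>, the image of the
  interval below that modulus contains \<open>c\<close>, and its solid hull contains the whole
  sequence.\<close>

lemma order_L_weakly_compact_imp_disjoint_null:
  assumes E: "\<exists>e::'e::banach_lattice. e \<noteq> 0"
    and LW: "\<And>T :: 'e \<Rightarrow> 'f::banach_lattice.
      bounded_linear T \<Longrightarrow> order_bounded_map T \<Longrightarrow> order_L_weakly_compact T"
  shows "disjoint_null TYPE('f)"
  unfolding disjoint_null_def
proof (intro allI impI)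
  fix x :: "nat \<Rightarrow> 'f" and c
  assume x: "disjoint_seq x \<and> (\<forall>n. 0 \<le> x n \<and> x n \<le> c)"
  then have "0 \<le> c"
    by (meson order_trans)
  obtain e :: 'e where "e \<noteq> 0"
    using E by blast
  then have "\<bar>e\<bar> \<noteq> 0"
    by simp
  then obtain f :: "'e \<Rightarrow> real" where f: "bounded_linear f" "f \<bar>e\<bar> = 1"
    using bounded_functional_nonzero by blast
  define T where "T a = f a *\<^sub>R c" for a
  have "bounded_linear T"
    unfolding T_def by (rule bounded_linear_compose[OF bounded_linear_scaleR_left f(1)])
  moreover have "order_bounded_map T"
    unfolding order_bounded_map_def
  proof (intro allI impI)
    fix A :: "'e set" assume "order_bounded_set A"
    then obtain l u where lu: "A \<subseteq> {l..u}"
      unfolding order_bounded_set_def by blast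
    obtain K where K: "\<And>a. norm (f a) \<le> norm a * K" "0 < K"
      using bounded_linear.pos_bounded[OF f(1)] by blast
    \<comment> \<open>Order intervals are norm bounded: compare \<open>a - l\<close> with
      \<open>u - l\<close>. So \<open>f\<close> is bounded by \<open>M\<close> on
      \<open>A\<close>.\<close>
    define M where "M = (norm (u - l) + norm l) * K"
    have "T a \<in> {(- M) *\<^sub>R c..M *\<^sub>R c}" if "a \<in> A" for a
    proof -
      have "norm (a - l) \<le> norm (u - l)"
        using lu that by (intro norm_mono_nonneg) auto
      then have "norm a \<le> norm (u - l) + norm l"
        using norm_triangle_ineq[of "a - l" l] by simp
      then have "\<bar>f a\<bar> \<le> M"
        using K(1)[of a] K(2) unfolding M_def by (smt (verit) mult_right_mono real_norm_def)
      then show ?thesis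
        using \<open>0 \<le> c\<close> unfolding T_def atLeastAtMost_iff
        by (intro conjI scaleR_right_mono) auto
    qed
    then show "order_bounded_set (T ` A)"
      unfolding order_bounded_set_def by blast
  qed
  ultimately have "order_L_weakly_compact T"
    by (rule LW)
  then have "L_weakly_compact (T ` {0..\<bar>e\<bar>})"
    unfolding order_L_weakly_compact_def by simp
  moreover have "range x \<subseteq> solid_hull (T ` {0..\<bar>e\<bar>})"
  proof -
    have "c \<in> T ` {0..\<bar>e\<bar>}"
      using f(2) by (intro image_eqI[of _ _ "\<bar>e\<bar>"]) (auto simp: T_def)
    moreover have "\<bar>x n\<bar> \<le> \<bar>c\<bar>" for n
      using x \<open>0 \<le> c\<close> by simp
    ultimately show ?thesis
      unfolding solid_hull_def by blast
  qed
  ultimately show "(\<lambda>n. norm (x n)) \<longlonglongrightarrow> 0"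
    using x unfolding L_weakly_compact_def by blast
qed

section \<open>From disjoint to k-disjoint sequences\<close>

text \<open>If all norms were at least \<open>3 * e\<close>, removing overlaps of total norm at most
  \<open>2 * e\<close> would leave an order bounded disjoint sequence with norms at least
  \<open>e\<close>.\<close>

lemma almost_disjoint_not_bounded_below:
  fixes w :: "nat \<Rightarrow> 'a::banach_lattice"
  assumes dn: "disjoint_null TYPE('a)"
    and nonneg: "\<And>n. 0 \<le> w n" and le: "\<And>n. w n \<le> c" and "0 < e"
    and small: "\<And>m n. m < n \<Longrightarrow> norm (inf (w m) (w n)) \<le> e * (1/2) ^ n"
  shows "\<exists>n. norm (w n) < 3 * e"
proof (rule ccontr)
  assume "\<not> ?thesis"
  then have big: "3 * e \<le> norm (w n)" for n
    by (meson not_less)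
  define g where "g n i = (if i = n then 0 else inf (w i) (w n))" for n i
  \<comment> \<open>Subtracting all overlaps from \<open>w n\<close> makes the sequence disjoint at a norm cost of at most \<open>2 * e\<close>.\<close>
  define v where "v n = sup (w n - suminf (g n)) 0" for n
  have g_nonneg: "0 \<le> g n i" for n i
    using nonneg by (simp add: g_def)
  \<comment> \<open>The bound must not depend on \<open>n\<close>: for \<open>i < n\<close> the
    hypothesis gives the even smaller power with exponent \<open>n\<close>.\<close>
  have g_le: "norm (g n i) \<le> e * (1/2) ^ i" for n i
  proof -
    consider "i < n" | "i = n" | "n < i"
      by linarith
    then show ?thesis
    proof cases
      case 1
      then have "(1/2 :: real) ^ n \<le> (1/2) ^ i"
        by (intro power_decreasing) auto
      then show ?thesis
        using small[OF 1] 1 \<open>0 < e\<close> mult_left_mono[of "(1/2 :: real) ^ n" "(1/2) ^ i" e]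
        unfolding g_def by (simp only: less_imp_neq if_False) (rule order_trans, auto)
    next
      case 3
      then show ?thesis
        using small[OF 3] by (simp add: g_def inf.commute)
    qed (use \<open>0 < e\<close> in \<open>simp add: g_def\<close>)
  qed
  have sums: "(\<lambda>i. e * (1/2) ^ i) sums (e * 2)"
    using sums_mult[OF geometric_sums[of "1/2 :: real"], of e] by simp
  have "summable (\<lambda>i. norm (g n i))" for n
    using g_le by (intro summable_comparison_test'[OF sums_summable[OF sums]]) auto
  note summable = this summable_norm_cancel[OF this]
  have "norm (suminf (g n)) \<le> 2 * e" for n
  proof -
    have "(\<Sum>i. norm (g n i)) \<le> (\<Sum>i. e * (1/2) ^ i)"
      by (intro suminf_le g_le summable(1) sums_summable[OF sums])
    with summable_norm[OF summable(1)[of n]] sums_unique[OF sums] show ?thesis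
      by linarith
  qed
  moreover have "norm (w n) \<le> norm (v n) + norm (suminf (g n))" for n
  proof -
    have "w n \<le> v n + suminf (g n)"
      using sup.cobounded1[of "w n - suminf (g n)" 0] by (simp only: v_def diff_le_eq)
    then have "norm (w n) \<le> norm (v n + suminf (g n))"
      by (intro norm_mono_nonneg nonneg)
    also have "\<dots> \<le> norm (v n) + norm (suminf (g n))"
      by (rule norm_triangle_ineq)
    finally show ?thesis .
  qed
  ultimately have v_big: "e \<le> norm (v n)" for n
    using big[of n] by (smt (verit, best))
  have v_nonneg: "0 \<le> v n" for n
    by (simp add: v_def)
  have v_diff: "v n \<le> w n - inf (w m) (w n)" if "m \<noteq> n" for m n
    unfolding v_def
  proof (rule sup_least)
    show "w n - suminf (g n) \<le> w n - inf (w m) (w n)"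
    proof (rule diff_left_mono)
      have "inf (w m) (w n) = g n m"
        using that by (simp add: g_def)
      also have "\<dots> \<le> suminf (g n)"
        by (intro le_suminf_lattice summable(2) g_nonneg)
      finally show "inf (w m) (w n) \<le> suminf (g n)" .
    qed
  qed (simp only: diff_ge_0_iff_ge inf.cobounded2)
  have disj: "inf (v m) (v n) = 0" if "m \<noteq> n" for m n
  proof (rule antisym)
    \<comment> \<open>Both terms lose at least the same element \<open>inf (w m) (w n)\<close>, and
      translating the infimum by it leaves 0.\<close>
    have "inf (v m) (v n) \<le> inf (w m - inf (w m) (w n)) (w n - inf (w m) (w n))"
      using v_diff[OF that] v_diff[OF that[symmetric]] by (intro inf_mono) (auto simp: inf.commute)
    also have "\<dots> = inf (w m) (w n) - inf (w m) (w n)"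
      unfolding diff_conv_add_uminus by (simp only: add_inf_distrib_right)
    finally show "inf (v m) (v n) \<le> 0"
      by simp
  qed (use v_nonneg in simp)
  have v_le: "v n \<le> c" for n
  proof -
    have "v n \<le> w n - inf (w (Suc n)) (w n)"
      by (rule v_diff) simp
    also have "\<dots> \<le> w n"
      using nonneg by simp
    also have "\<dots> \<le> c"
      by (rule le)
    finally show ?thesis .
  qed
  have "(\<lambda>n. norm (v n)) \<longlonglongrightarrow> 0"
  proof (rule dn[unfolded disjoint_null_def, rule_format], intro conjI allI)
    show "disjoint_seq v"
      using disj v_nonneg by (simp add: disjoint_seq_def)
  qed (rule v_nonneg, rule v_le)
  then have "e \<le> 0"
    using v_big by (intro LIMSEQ_le_const) auto
  with \<open>0 < e\<close> show False
    by simp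
qed

text \<open>Otherwise some subsequence stays at norm at least \<open>e\<close> while its overlaps
  decay geometrically, against the preceding lemma with \<open>e / 3\<close>.\<close>

lemma pairwise_null_imp_small:
  fixes w :: "nat \<Rightarrow> 'a::banach_lattice"
  assumes dn: "disjoint_null TYPE('a)"
    and nonneg: "\<And>n. 0 \<le> w n" and le: "\<And>n. w n \<le> c"
    and pair: "\<And>m. (\<lambda>n. norm (inf (w m) (w n))) \<longlonglongrightarrow> 0"
  shows "(\<lambda>n. norm (w n)) \<longlonglongrightarrow> 0"
proof (rule ccontr)
  assume "\<not> ?thesis"
  then obtain e where "0 < e" and big: "\<And>N. \<exists>n\<ge>N. e \<le> norm (w n)"
    unfolding LIMSEQ_iff by (force simp: not_less)
  define d where "d = e / 3"
  have "0 < d"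
    using \<open>0 < e\<close> by (simp add: d_def)
  define P where "P k n \<longleftrightarrow> e \<le> norm (w n)" for k :: nat and n
  \<comment> \<open>Controlling all \<open>m \<le> n\<close> covers every index chosen before;
    \<open>Suc k\<close> is the position of \<open>n'\<close> in the subsequence.\<close>
  define Q where "Q k n n' \<longleftrightarrow> n < n' \<and>
    (\<forall>m\<le>n. norm (inf (w m) (w n')) \<le> d * (1/2) ^ Suc k)" for k n n'
  have "\<exists>h. \<forall>k. P k (h k) \<and> Q k (h k) (h (Suc k))"
  proof (rule dependent_nat_choice)
    show "\<exists>n. P 0 n"
      using big unfolding P_def by blast
    fix n k
    have "\<forall>\<^sub>F n' in sequentially. norm (inf (w m) (w n')) < d * (1/2) ^ Suc k" for m
      using \<open>0 < d\<close> by (intro order_tendstoD(2)[OF pair]) simp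
    then have "\<forall>\<^sub>F n' in sequentially. \<forall>m\<in>{..n}. norm (inf (w m) (w n')) < d * (1/2) ^ Suc k"
      by (intro eventually_ball_finite) auto
    then obtain N where N: "\<And>n' m. N \<le> n' \<Longrightarrow> m \<le> n \<Longrightarrow>
        norm (inf (w m) (w n')) < d * (1/2) ^ Suc k"
      unfolding eventually_sequentially by auto
    obtain n' where "max N (Suc n) \<le> n'" "e \<le> norm (w n')"
      using big by blast
    then show "\<exists>n'. P (Suc k) n' \<and> Q k n n'"
      using N unfolding P_def Q_def by (intro exI[of _ n']) (auto intro: less_imp_le)
  qed
  then obtain h where h: "\<And>k. P k (h k)" "\<And>k. Q k (h k) (h (Suc k))"
    by blast
  have "strict_mono h"
    using h(2) unfolding Q_def strict_mono_Suc_iff by blast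
  have "norm (inf (w (h i)) (w (h j))) \<le> d * (1/2) ^ j" if "i < j" for i j
  proof -
    obtain k where k: "j = Suc k"
      using less_imp_Suc_add[OF \<open>i < j\<close>] by blast
    then have "h i \<le> h k"
      using \<open>i < j\<close> \<open>strict_mono h\<close> by (simp add: strict_mono_less_eq)
    then show ?thesis
      using h(2)[of k] unfolding Q_def k by blast
  qed
  then have "\<exists>n. norm (w (h n)) < 3 * d"
    by (intro almost_disjoint_not_bounded_below[OF dn nonneg le \<open>0 < d\<close>])
  then obtain n where "norm (w (h n)) < 3 * d" ..
  then show False
    using h(1)[of n] by (simp add: P_def d_def)
qed

text \<open>The last assumption says, by way of lower bounds, that any \<open>Suc k\<close> terms
  have infimum 0. In the induction the infima with a fixed \<open>w m\<close> fall under the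
  hypothesis for one term fewer, so they are null and \<open>pairwise_null_imp_small\<close>
  applies.\<close>

lemma k_disjoint_null:
  fixes w :: "nat \<Rightarrow> 'a::banach_lattice"
  assumes dn: "disjoint_null TYPE('a)"
    and "\<And>n. 0 \<le> w n" "\<And>n. w n \<le> c"
    and "\<And>A z. finite A \<Longrightarrow> card A = Suc k \<Longrightarrow> (\<And>i. i \<in> A \<Longrightarrow> z \<le> w i) \<Longrightarrow> z \<le> 0"
  shows "(\<lambda>n. norm (w n)) \<longlonglongrightarrow> 0"
  using assms(2-4)
proof (induction k arbitrary: w)
  case 0
  have "w n = 0" for n
    using "0.prems"(1)[of n] "0.prems"(3)[of "{n}" "w n"] by (simp add: antisym)
  then show ?case
    by simp
next
  case (Suc k)
  show ?case
  proof (rule pairwise_null_imp_small[OF dn Suc.prems(1,2)])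
    \<comment> \<open>Past index \<open>m\<close>, any \<open>Suc k\<close> of the infima with \<open>w m\<close> involve \<open>Suc (Suc k)\<close> terms of \<open>w\<close>.\<close>
    fix m
    have "(\<lambda>n. norm (inf (w m) (w (n + Suc m)))) \<longlonglongrightarrow> 0"
    proof (rule Suc.IH)
      show "0 \<le> inf (w m) (w (n + Suc m))" for n
        using Suc.prems(1) by simp
      show "inf (w m) (w (n + Suc m)) \<le> c" for n
        using Suc.prems(2)[of m] by (rule le_infI1)
      fix A z assume A: "finite A" "card A = Suc k"
        and z: "\<And>i. i \<in> A \<Longrightarrow> z \<le> inf (w m) (w (i + Suc m))"
      define B where "B = insert m ((\<lambda>i. i + Suc m) ` A)"
      have "card ((\<lambda>i. i + Suc m) ` A) = Suc k"
        using A(2) by (subst card_image) (simp_all add: inj_on_def)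
      then have "finite B" "card B = Suc (Suc k)"
        using A(1) unfolding B_def by (auto simp: card_insert_if simp del: add_Suc_right)
      moreover have "z \<le> w i" if "i \<in> B" for i
      proof -
        \<comment> \<open>Some member of \<open>A\<close> is needed to conclude
          \<open>z \<le> w m\<close>.\<close>
        obtain a where "a \<in> A"
          using A by fastforce
        then show ?thesis
          using z that unfolding B_def by auto
      qed
      ultimately show "z \<le> 0"
        by (rule Suc.prems(3))
    qed
    then show "(\<lambda>n. norm (inf (w m) (w n))) \<longlonglongrightarrow> 0"
      by (rule LIMSEQ_offset)
  qed
qed

section \<open>Positive series with bounded partial sums\<close>

text \<open>The witness is the infimum of \<open>u\<close> over \<open>A\<close>: by translation and
  distributivity, finite infima commute with subtracting \<open>c\<close> and taking the positive
  part.\<close>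

lemma finite_common_lower_bound:
  fixes u :: "'i \<Rightarrow> 'a::banach_lattice"
  assumes "finite A" "A \<noteq> {}"
  shows "\<exists>m. (\<forall>i\<in>A. m \<le> u i) \<and> (\<forall>z. (\<forall>i\<in>A. z \<le> sup (u i - c) 0) \<longrightarrow> z \<le> sup (m - c) 0)"
  using assms
proof (induction rule: finite_ne_induct)
  case (singleton i)
  then show ?case
    by (intro exI[of _ "u i"]) simp
next
  case (insert i A)
  then obtain m where m: "\<forall>i\<in>A. m \<le> u i"
    "\<And>z. \<forall>i\<in>A. z \<le> sup (u i - c) 0 \<Longrightarrow> z \<le> sup (m - c) 0"
    by blast
  have "sup (inf (u i) m - c) 0 = inf (sup (u i - c) 0) (sup (m - c) 0)"
    unfolding diff_conv_add_uminus by (simp only: add_inf_distrib_right sup_inf_distrib2)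
  then show ?case
    using m by (intro exI[of _ "inf (u i) m"]) (auto intro: le_infI2)
qed

text \<open>Put \<open>b = c / Suc k\<close>. A common lower bound \<open>m\<close> of
  \<open>Suc k\<close> terms has \<open>Suc k\<close> times \<open>m\<close> below \<open>c\<close>,
  so \<open>m \<le> b\<close>; hence any \<open>Suc k\<close> of the positive parts of
  \<open>u n - b\<close> have infimum 0. They are null, and \<open>u n\<close> exceeds them by at
  most \<open>b\<close>.\<close>

lemma bounded_sums_null:
  fixes u :: "nat \<Rightarrow> 'a::banach_lattice"
  assumes dn: "disjoint_null TYPE('a)"
    and nonneg: "\<And>n. 0 \<le> u n" and sum: "\<And>n. (\<Sum>i<n. u i) \<le> c"
  shows "(\<lambda>n. norm (u n)) \<longlonglongrightarrow> 0"
proof (rule LIMSEQ_I)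
  fix e :: real assume "0 < e"
  have sumA: "sum u A \<le> c" if "finite A" for A
  proof -
    obtain n where "A \<subseteq> {..<n}"
      using finite_nat_bounded[OF \<open>finite A\<close>] by blast
    then have "sum u A \<le> (\<Sum>i<n. u i)"
      using nonneg by (intro sum_mono2) auto
    also have "\<dots> \<le> c"
      by (rule sum)
    finally show ?thesis .
  qed
  then have "0 \<le> c"
    using sumA[of "{}"] by simp
  \<comment> \<open>This choice makes \<open>norm b < e / 2\<close>.\<close>
  obtain k where k: "norm c * 2 / e < real (Suc k)"
    using reals_Archimedean2 by (metis less_Suc_eq of_nat_less_iff order_less_trans)
  define b where "b = inverse (real (Suc k)) *\<^sub>R c"
  have "0 \<le> b"
    using \<open>0 \<le> c\<close> by (simp add: b_def scaleR_nonneg_nonneg)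
  have "norm b < e / 2"
    using k \<open>0 < e\<close> by (simp add: b_def field_simps del: of_nat_Suc)
  define w where "w n = sup (u n - b) 0" for n
  have "(\<lambda>n. norm (w n)) \<longlonglongrightarrow> 0"
  proof (rule k_disjoint_null[OF dn])
    show "0 \<le> w n" for n
      by (simp add: w_def)
    have "u n \<le> c" for n
      using sumA[of "{n}"] by simp
    then show "w n \<le> c" for n
      using \<open>0 \<le> c\<close> \<open>0 \<le> b\<close> order_trans[of "u n - b" "u n" c] by (simp add: w_def)
    fix A z assume A: "finite A" "card A = Suc k" and z: "\<And>i. i \<in> A \<Longrightarrow> z \<le> w i"
    then have "A \<noteq> {}"
      by auto
    then obtain m where m: "\<forall>i\<in>A. m \<le> u i" "z \<le> sup (m - b) 0"
      using finite_common_lower_bound[OF A(1), of u b] z unfolding w_def by blast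
    have "real (Suc k) *\<^sub>R m = (\<Sum>i\<in>A. m)"
      using A by (simp add: sum_constant_scaleR)
    also have "\<dots> \<le> sum u A"
      using m(1) by (intro sum_mono) auto
    also have "\<dots> \<le> c"
      using A(1) by (rule sumA)
    finally have "inverse (real (Suc k)) *\<^sub>R (real (Suc k) *\<^sub>R m) \<le> b"
      unfolding b_def by (intro scaleR_left_mono) auto
    then have "m \<le> b"
      by (simp del: of_nat_Suc)
    then show "z \<le> 0"
      using m(2) by (simp add: sup_absorb2)
  qed
  then obtain N where N: "\<And>n. N \<le> n \<Longrightarrow> norm (w n) < e / 2"
    using \<open>0 < e\<close> LIMSEQ_D[of _ 0 "e / 2"] by fastforce
  have "norm (u n) < e" if "N \<le> n" for n
  proof -
    have "u n \<le> w n + b"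
      using sup.cobounded1[of "u n - b" 0] by (simp only: w_def diff_le_eq)
    then have "norm (u n) \<le> norm (w n + b)"
      by (intro norm_mono_nonneg nonneg)
    also have "\<dots> < e"
      using norm_triangle_ineq[of "w n" b] N[OF that] \<open>norm b < e / 2\<close> by linarith
    finally show ?thesis .
  qed
  then show "\<exists>N. \<forall>n\<ge>N. norm (norm (u n) - 0) < e"
    by auto
qed

section \<open>Decreasing nets\<close>

text \<open>Otherwise there is a sequence of successive indices along which \<open>x\<close> drops
  by norm at least \<open>e\<close> each time. The drops are positive and telescope to at most
  \<open>x (h 0)\<close>, so they must be null.\<close>

lemma decreasing_net_Cauchy:
  fixes x :: "'i \<Rightarrow> 'a::banach_lattice"
  assumes dn: "disjoint_null TYPE('a)" and dir: "directed_preorder I le"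
    and mono: "\<And>i j. i \<in> I \<Longrightarrow> j \<in> I \<Longrightarrow> le i j \<Longrightarrow> x j \<le> x i"
    and nonneg: "\<And>i. i \<in> I \<Longrightarrow> 0 \<le> x i" and "0 < e"
  shows "\<exists>i\<in>I. \<forall>j\<in>I. le i j \<longrightarrow> norm (x i - x j) < e"
proof (rule ccontr)
  assume "\<not> ?thesis"
  then have step: "\<exists>j\<in>I. le i j \<and> e \<le> norm (x i - x j)" if "i \<in> I" for i
    using that by (meson not_less)
  have "\<exists>h. \<forall>n. h n \<in> I \<and> le (h n) (h (Suc n)) \<and> e \<le> norm (x (h n) - x (h (Suc n)))"
  proof (rule dependent_nat_choice)
    show "\<exists>i. i \<in> I"
      using dir unfolding directed_preorder_def by blast
  qed (use step in blast)
  then obtain h where h: "\<And>n. h n \<in> I" "\<And>n. le (h n) (h (Suc n))"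
    "\<And>n. e \<le> norm (x (h n) - x (h (Suc n)))"
    by blast
  have "(\<lambda>n. norm (x (h n) - x (h (Suc n)))) \<longlonglongrightarrow> 0"
  proof (rule bounded_sums_null[OF dn])
    show "0 \<le> x (h n) - x (h (Suc n))" for n
      using mono h by simp
    have "(\<Sum>i<n. x (h i) - x (h (Suc i))) = x (h 0) - x (h n)" for n
      by (rule sum_lessThan_telescope')
    then show "(\<Sum>i<n. x (h i) - x (h (Suc i))) \<le> x (h 0)" for n
      using nonneg h by simp
  qed
  then have "e \<le> 0"
    using h(3) by (intro LIMSEQ_le_const) auto
  with \<open>0 < e\<close> show False
    by simp
qed

lemma disjoint_null_imp_net_norm_null:
  fixes x :: "'i \<Rightarrow> 'a::banach_lattice"
  assumes dn: "disjoint_null TYPE('a)" and dir: "directed_preorder I le"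
    and dec: "net_decreasing_to_0 I le x"
  shows "net_norm_null I le x"
proof -
  have mono: "\<And>i j. i \<in> I \<Longrightarrow> j \<in> I \<Longrightarrow> le i j \<Longrightarrow> x j \<le> x i"
    and nonneg: "\<And>i. i \<in> I \<Longrightarrow> 0 \<le> x i"
    and inf: "\<And>z. (\<And>i. i \<in> I \<Longrightarrow> z \<le> x i) \<Longrightarrow> z \<le> 0"
    using dec unfolding net_decreasing_to_0_def by blast+
  have ub: "\<exists>k\<in>I. le i k \<and> le j k" if "i \<in> I" "j \<in> I" for i j
    using dir that unfolding directed_preorder_def by blast
  have "\<exists>i\<in>I. \<forall>j\<in>I. le i j \<longrightarrow> norm (x i - x j) < inverse (real (Suc n))" for n
    using dn dir mono nonneg by (rule decreasing_net_Cauchy) auto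
  then obtain g where g: "\<And>n. g n \<in> I"
    and small: "\<And>n j. j \<in> I \<Longrightarrow> le (g n) j \<Longrightarrow> norm (x (g n) - x j) < inverse (real (Suc n))"
    by metis
  have "Cauchy (\<lambda>n. x (g n))"
  proof (rule metric_CauchyI)
    fix e :: real assume "0 < e"
    then obtain N where N: "inverse (real (Suc N)) < e / 2"
      using reals_Archimedean[of "e / 2"] by auto
    have *: "inverse (real (Suc n)) < e / 2" if "N \<le> n" for n
    proof -
      have "inverse (real (Suc n)) \<le> inverse (real (Suc N))"
        using that by (intro le_imp_inverse_le) auto
      with N show ?thesis
        by linarith
    qed
    have "dist (x (g m)) (x (g n)) < e" if mn: "N \<le> m" "N \<le> n" for m n
    proof -
      \<comment> \<open>The indices \<open>g n\<close> need not increase, so two of them are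
        compared through a common successor.\<close>
      obtain k where "k \<in> I" "le (g m) k" "le (g n) k"
        using ub g by blast
      then have "dist (x (g m)) (x k) < e / 2" "dist (x (g n)) (x k) < e / 2"
        using small *[OF mn(1)] *[OF mn(2)] unfolding dist_norm by (blast intro: less_trans)+
      then show ?thesis
        by (rule dist_triangle_half_l)
    qed
    then show "\<exists>M. \<forall>m\<ge>M. \<forall>n\<ge>M. dist (x (g m)) (x (g n)) < e"
      by blast
  qed
  then obtain y where y: "(\<lambda>n. x (g n)) \<longlonglongrightarrow> y"
    by (auto simp: Cauchy_convergent_iff convergent_def)
  have "y \<le> x j" if "j \<in> I" for j
  proof -
    \<comment> \<open>Indices beyond both \<open>g n\<close> and \<open>j\<close> give values below
      \<open>x j\<close> with the same limit \<open>y\<close>.\<close>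
    have "\<forall>n. \<exists>k. k \<in> I \<and> le (g n) k \<and> le j k"
      using ub g that by blast
    then obtain k where k: "\<And>n. k n \<in> I" "\<And>n. le (g n) (k n)" "\<And>n. le j (k n)"
      by metis
    have "(\<lambda>n. x (g n) - x (k n)) \<longlonglongrightarrow> 0"
    proof (rule Lim_null_comparison)
      show "\<forall>\<^sub>F n in sequentially. norm (x (g n) - x (k n)) \<le> inverse (real (Suc n))"
        by (intro always_eventually allI less_imp_le small k)
    qed (rule LIMSEQ_inverse_real_of_nat)
    with y have "(\<lambda>n. x (g n) - (x (g n) - x (k n))) \<longlonglongrightarrow> y - 0"
      by (rule tendsto_diff)
    then have "(\<lambda>n. x (k n)) \<longlonglongrightarrow> y"
      by simp
    then show ?thesis
      by (rule tendsto_le_lattice[OF _ tendsto_const]) (use mono k that in blast)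
  qed
  then have "y \<le> 0"
    by (rule inf)
  moreover have "0 \<le> y"
    using tendsto_nonneg_lattice[OF y] nonneg g by blast
  ultimately have "(\<lambda>n. x (g n)) \<longlonglongrightarrow> 0"
    using y by simp
  show ?thesis
    unfolding net_norm_null_def
  proof (intro allI impI)
    fix e :: real assume "0 < e"
    then obtain n where n: "norm (x (g n)) < e"
      using LIMSEQ_D[OF \<open>(\<lambda>n. x (g n)) \<longlonglongrightarrow> 0\<close>, of e] by auto
    have "norm (x j) < e" if "j \<in> I" "le (g n) j" for j
      using norm_mono_nonneg[OF nonneg mono, of j "g n"] that g n by fastforce
    then show "\<exists>i\<in>I. \<forall>j\<in>I. le i j \<longrightarrow> norm (x j) < e"
      using g by blast
  qed
qed

theorem theorem2p4:
  assumes "\<exists>x::'e::banach_lattice. x \<noteq> 0"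
    and "\<exists>y::'f::banach_lattice. y \<noteq> 0"
  shows "(\<forall>T :: 'e \<Rightarrow> 'f. bounded_linear T \<and> order_bounded_map T \<longrightarrow> order_L_weakly_compact T)
    \<longleftrightarrow> order_continuous_norm TYPE('f)"
proof
  assume "\<forall>T :: 'e \<Rightarrow> 'f. bounded_linear T \<and> order_bounded_map T \<longrightarrow> order_L_weakly_compact T"
  then have "disjoint_null TYPE('f)"
    using order_L_weakly_compact_imp_disjoint_null[OF assms(1)] by blast
  then show "order_continuous_norm TYPE('f)"
    unfolding order_continuous_norm_def using disjoint_null_imp_net_norm_null by blast
next
  assume "order_continuous_norm TYPE('f)"
  then show "\<forall>T :: 'e \<Rightarrow> 'f. bounded_linear T \<and> order_bounded_map T \<longrightarrow> order_L_weakly_compact T"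
    using order_bounded_imp_order_L_weakly_compact by blast
qed

end
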